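(* Let $G=\{0,1\}^{\mathbb{N}}$, $\Theta=(0,1)$, and for $\theta\in\Theta$ let $\mu_\theta^{\mathbb{N}}$ be the infinite power on $G$ of the measure $\mu_\theta$ on $\{0,1\}$ with $\mu_\theta(\{1\})=\theta$ and $\mu_\theta(\{0\})=1-\theta$. Let $\Theta_1$ be a subset of $\Theta$ with $\mathrm{card}(\Theta_1)\ge 2$. Then there exists an objective consistent estimate of the unknown parameter $\theta$ for the statistical structure $\{(G,\mathcal{B}(G),\mu_\theta^{\mathbb{N}}):\theta\in\Theta_1\}$ if and only if $\mathrm{card}(\Theta_1)\le\aleph_0$ and $1/2\notin\Theta_1$.
   Context: $G=\{0,1\}^{\mathbb{N}}$ is the compact Polish group with coordinatewise addition modulo $2$ and product topology, with the invariant metric $\rho((x_k),(y_k))=\sum_{k\in\mathbb{N}}\frac{|x_k-y_k \pmod 2|}{2^{k+1}(1+|x_k-y_k\pmod 2|)}$; $\mathcal{B}(G)$ is its Borel $\sigma$-algebra. A Borel set $X\subseteq G$ is shy if there is a Borel probability measure $\mu$ on $G$ with $\mu(f+X+g)=0$ for all $f,g\in G$; a subset of a Borel shy set is also called shy (in the compact group $G$ this is equivalent to having Haar measure zero). The complement of a shy set is prevalent. A Borel set is Haar ambivalent if it is neither shy nor prevalent. For a non-empty set $\Theta_1$ let $L(\Theta_1)$ be the $\sigma$-algebra generated by all singletons of $\Theta_1$. A $(\mathcal{B}(G),L(\Theta_1))$-measurable mapping $T:G\to\Theta_1$ is an objective consistent estimate of $\theta$ for a statistical structure $\{(G,\mathcal{B}(G),\nu_\theta):\theta\in\Theta_1\}$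 (a family of Borel probability measures $\nu_\theta$ on $G$) if $\nu_\theta(T^{-1}(\theta))=1$ and $T^{-1}(\theta)$ is a Haar ambivalent set, for each $\theta\in\Theta_1$. *)

theory Defs
  imports
    "HOL-Probability.Probability"
    "HOL-Library.Z2"
    "HOL-Library.Function_Algebras"
begin

text \<open>
  The group \<open>{0,1}\<^sup>\<nat>\<close> is the type \<^typ>\<open>nat \<Rightarrow> bit\<close>: \<^typ>\<open>bit\<close> is the field with two elements,
  addition of functions is pointwise, and functions carry the product topology. What the libraries
  do not provide is the discrete topology on \<^typ>\<open>bit\<close> and the fact that a power of a topological
  group is a topological group.
\<close>

instantiation bit :: discrete_topology
begin

definition open_bit :: "bit set \<Rightarrow> bool"
  where "open_bit A \<longleftrightarrow> True"

instance
  by standard (simp_all add: open_bit_def)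

end

instance bit :: finite
proof
  have "(UNIV :: bit set) = {0, 1}"
    by auto
  then show "finite (UNIV :: bit set)"
    by (metis finite.emptyI finite.insertI)
qed

instance bit :: second_countable_topology
proof
  show "\<exists>B :: bit set set. countable B \<and> open = generate_topology B"
  proof (intro exI conjI)
    show "countable (UNIV :: bit set set)"
      by (intro countable_finite) simp
    show "open = generate_topology (UNIV :: bit set set)"
      by (auto simp: fun_eq_iff open_bit_def intro: generate_topology.Basis)
  qed
qed

instance bit :: topological_group_add
proof
  fix a b :: bit
  have *: "nhds c = principal {c}" for c :: bit
    by (rule nhds_discrete)
  show "((\<lambda>x. fst x + snd x) \<longlongrightarrow> a + b) (nhds a \<times>\<^sub>F nhds b)"
    unfolding * principal_prod_principal by (auto simp: filterlim_principal eventually_principal)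
  show "(uminus \<longlongrightarrow> - a) (nhds a)"
    unfolding * by (auto simp: filterlim_principal eventually_principal)
qed

instance "fun" :: (type, topological_group_add) topological_group_add
proof
  fix a b :: "'a \<Rightarrow> 'b"
  have "continuous_on UNIV (\<lambda>x :: ('a \<Rightarrow> 'b) \<times> ('a \<Rightarrow> 'b). fst x + snd x)"
  proof (rule continuous_on_coordinatewise_then_product)
    fix i :: 'a
    have "continuous_on UNIV (\<lambda>x :: ('a \<Rightarrow> 'b) \<times> ('a \<Rightarrow> 'b). fst x i + snd x i)"
      by (intro continuous_intros continuous_on_product_then_coordinatewise)
    then show "continuous_on UNIV (\<lambda>x :: ('a \<Rightarrow> 'b) \<times> ('a \<Rightarrow> 'b). (fst x + snd x) i)"
      by simp
  qed
  then have "((\<lambda>x. fst x + snd x) \<longlongrightarrow> fst (a, b) + snd (a, b)) (at (a, b))"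
    unfolding continuous_on_def by blast
  then show "((\<lambda>x. fst x + snd x) \<longlongrightarrow> a + b) (nhds a \<times>\<^sub>F nhds b)"
    using tendsto_at_iff_tendsto_nhds [of "\<lambda>x. fst x + snd x" "(a, b)"] by (simp add: nhds_prod)
  have "continuous_on UNIV (uminus :: ('a \<Rightarrow> 'b) \<Rightarrow> _)"
  proof (rule continuous_on_coordinatewise_then_product)
    fix i :: 'a
    have "continuous_on UNIV (\<lambda>x :: 'a \<Rightarrow> 'b. - x i)"
      by (intro continuous_intros continuous_on_product_then_coordinatewise)
    then show "continuous_on UNIV (\<lambda>x :: 'a \<Rightarrow> 'b. (- x) i)"
      by simp
  qed
  then have "(uminus \<longlongrightarrow> - a) (at a)"
    unfolding continuous_on_def by blast
  then show "(uminus \<longlongrightarrow> - a) (nhds a)"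
    by (simp add: tendsto_at_iff_tendsto_nhds)
qed

definition borel_prob :: "'a::topological_space measure \<Rightarrow> bool"
  where "borel_prob \<mu> \<longleftrightarrow> prob_space \<mu> \<and> sets \<mu> = sets borel"

definition borel_shy :: "'a::topological_group_add set \<Rightarrow> bool"
  where "borel_shy X \<longleftrightarrow> X \<in> sets borel \<and>
    (\<exists>\<mu>. borel_prob \<mu> \<and> (\<forall>f g. emeasure \<mu> ((\<lambda>x. f + x + g) ` X) = 0))"

definition shy :: "'a::topological_group_add set \<Rightarrow> bool"
  where "shy X \<longleftrightarrow> (\<exists>B. X \<subseteq> B \<and> borel_shy B)"

definition prevalent :: "'a::topological_group_add set \<Rightarrow> bool"
  where "prevalent X \<longleftrightarrow> shy (- X)"

definition haar_ambivalent :: "'a::topological_group_add set \<Rightarrow> bool"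
  where "haar_ambivalent X \<longleftrightarrow> X \<in> sets borel \<and> \<not> shy X \<and> \<not> prevalent X"

text \<open>
  \<^const>\<open>emeasure\<close> is \<open>0\<close> on non-measurable sets, so the definition of shyness relies on the
  translates of Borel sets being Borel.
\<close>

lemma translate_borel:
  fixes X :: "'a::topological_group_add set"
  assumes "X \<in> sets borel"
  shows "(\<lambda>x. f + x + g) ` X \<in> sets borel"
proof -
  have "(\<lambda>x. f + x + g) ` X = (\<lambda>y. - f + y + - g) -` X \<inter> space borel"
  proof (intro set_eqI iffI)
    fix y assume "y \<in> (\<lambda>y. - f + y + - g) -` X \<inter> space borel"
    moreover have "y = f + (- f + y + - g) + g"
      by (metis add.assoc add.right_neutral left_minus right_minus add.left_neutral)
    ultimately show "y \<in> (\<lambda>x. f + x + g) ` X"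
      by blast
  qed (auto simp: add.assoc)
  moreover have "(\<lambda>y. - f + y + - g) \<in> borel \<rightarrow>\<^sub>M borel"
    by (intro borel_measurable_continuous_onI continuous_intros)
  ultimately show ?thesis
    using assms by (metis measurable_sets)
qed

text \<open>
  As a measure, \<^term>\<open>sigma \<Theta> A\<close> is zero; here it only serves as a carrier of the
  \<open>\<sigma>\<close>-algebra generated by the singletons of \<open>\<Theta>\<close>.
\<close>

definition singleton_algebra :: "'p set \<Rightarrow> 'p measure"
  where "singleton_algebra \<Theta> = sigma \<Theta> {{\<theta>} | \<theta>. \<theta> \<in> \<Theta>}"

definition statistical_structure :: "'p set \<Rightarrow> ('p \<Rightarrow> 'a::topological_space measure) \<Rightarrow> bool"
  where "statistical_structure \<Theta> \<nu> \<longleftrightarrow> (\<forall>\<theta>\<in>\<Theta>. borel_prob (\<nu> \<theta>))"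

definition objective_consistent_estimate ::
    "'p set \<Rightarrow> ('p \<Rightarrow> 'a::topological_group_add measure) \<Rightarrow> ('a \<Rightarrow> 'p) \<Rightarrow> bool"
  where "objective_consistent_estimate \<Theta> \<nu> T \<longleftrightarrow>
    statistical_structure \<Theta> \<nu> \<and>
    T \<in> borel \<rightarrow>\<^sub>M singleton_algebra \<Theta> \<and>
    (\<forall>\<theta>\<in>\<Theta>. emeasure (\<nu> \<theta>) (T -` {\<theta>}) = 1 \<and> haar_ambivalent (T -` {\<theta>}))"

definition bernoulli_bit :: "real \<Rightarrow> bit pmf"
  where "bernoulli_bit \<theta> = map_pmf of_bool (bernoulli_pmf \<theta>)"

lemma pmf_bernoulli_bit:
  assumes "0 \<le> \<theta>" "\<theta> \<le> 1"
  shows "pmf (bernoulli_bit \<theta>) 1 = \<theta>" "pmf (bernoulli_bit \<theta>) 0 = 1 - \<theta>"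
proof -
  have inj: "inj (of_bool :: bool \<Rightarrow> bit)"
    by (auto simp: inj_def)
  show "pmf (bernoulli_bit \<theta>) 1 = \<theta>"
    using assms pmf_map_inj' [OF inj, of "bernoulli_pmf \<theta>" True] by (simp add: bernoulli_bit_def)
  show "pmf (bernoulli_bit \<theta>) 0 = 1 - \<theta>"
    using assms pmf_map_inj' [OF inj, of "bernoulli_pmf \<theta>" False] by (simp add: bernoulli_bit_def)
qed

definition bernoulli_power :: "real \<Rightarrow> (nat \<Rightarrow> bit) measure"
  where "bernoulli_power \<theta> = (\<Pi>\<^sub>M i\<in>UNIV. measure_pmf (bernoulli_bit \<theta>))"

lemma statistical_structure_bernoulli_power: "statistical_structure \<Theta> bernoulli_power"
proof -
  have "borel_prob (bernoulli_power \<theta>)" for \<theta>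
  proof -
    have "sets (borel :: bit measure) = UNIV"
      by (auto simp: open_bit_def intro: borel_open)
    then have "sets (bernoulli_power \<theta>) = sets (\<Pi>\<^sub>M i\<in>UNIV. (borel :: bit measure))"
      unfolding bernoulli_power_def by (intro sets_PiM_cong) simp_all
    moreover have "prob_space (bernoulli_power \<theta>)"
      unfolding bernoulli_power_def by (intro prob_space_PiM measure_pmf.prob_space_axioms)
    ultimately show ?thesis
      by (simp add: borel_prob_def sets_PiM_equal_borel)
  qed
  then show ?thesis
    by (simp add: statistical_structure_def)
qed

end

theory Submission
  imports Defs
begin

text \<open>
  Write \<open>h\<close> for the \<open>1/2\<close>-power, the Haar measure of the group. Since \<open>h\<close> is an invariant
  probability measure, a Fubini argument on the addition map shows that a Borel set is shy exactly
  if \<open>h\<close> vanishes on it (\<open>borel_shy_iff_null\<close>). So a Borel set is Haar ambivalent if and only if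
  neither it nor its complement is \<open>h\<close>-null.

  Necessity: the fibres of an estimate are disjoint sets of positive \<open>h\<close>-measure, and a finite
  measure admits only countably many of these. If \<open>1/2\<close> were a parameter, then its fibre would have
  full \<open>h\<close>-measure because the measure to be estimated is \<open>h\<close> itself, and so would be prevalent.

  Sufficiency: by the strong law of large numbers the frequency of ones in a sequence is \<open>\<theta>\<close> almost
  surely under the \<open>\<theta>\<close>-power, so any measurable map that returns the frequency whenever it is a
  parameter is consistent. Under \<open>h\<close> the frequency is almost surely \<open>1/2\<close>, which is not a parameter; hence the
  values on these sequences are free to choose without harm to consistency. They are used to
  make every fibre ambivalent: the position of the first one takes each natural number with
  positive \<open>h\<close>-probability, and it selects a parameter through an enumeration. Each fibre then has
  positive \<open>h\<close>-measure, and its complement does too, as it contains the fibre of another parameter.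
\<close>

section \<open>Shyness and invariant probability measures\<close>

text \<open>
  For a witness \<open>m\<close> of shyness, integrate the indicator of \<open>x + y \<in> B\<close> with respect to
  \<open>h \<Otimes> m\<close>. For fixed \<open>x\<close> the integral over \<open>y\<close> is the \<open>m\<close>-measure of a translate of \<open>B\<close>, which is
  \<open>0\<close>; for fixed \<open>y\<close> the integral over \<open>x\<close> is the \<open>h\<close>-measure of a translate, which is that of \<open>B\<close>.
  Second countability makes addition measurable for the product \<open>\<sigma>\<close>-algebra. Conversely,
  \<open>h\<close> itself witnesses that its null sets are shy.
\<close>

lemma borel_shy_iff_null:
  fixes h :: "'a::{topological_group_add, second_countable_topology} measure"
  assumes "borel_prob h"
    and invariant: "\<And>f g X. X \<in> sets borel \<Longrightarrow> emeasure h ((\<lambda>x. f + x + g) ` X) = emeasure h X"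
    and B: "B \<in> sets borel"
  shows "borel_shy B \<longleftrightarrow> emeasure h B = 0"
proof
  assume "borel_shy B"
  then obtain m where "borel_prob m"
    and null: "\<And>f g. emeasure m ((\<lambda>x. f + x + g) ` B) = 0"
    by (auto simp: borel_shy_def)
  interpret h: prob_space h
    using \<open>borel_prob h\<close> by (simp add: borel_prob_def)
  interpret m: prob_space m
    using \<open>borel_prob m\<close> by (simp add: borel_prob_def)
  interpret pair_sigma_finite h m ..
  have [measurable_cong]: "sets h = sets borel" "sets m = sets borel"
    using assms \<open>borel_prob m\<close> by (simp_all add: borel_prob_def)
  have plus: "(\<lambda>z :: 'a \<times> 'a. fst z + snd z) \<in> borel_measurable borel"
    by (intro borel_measurable_continuous_onI continuous_intros)
  have sum_meas: "(\<lambda>z. fst z + snd z) \<in> h \<Otimes>\<^sub>M m \<rightarrow>\<^sub>M borel"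
  proof -
    have "sets (h \<Otimes>\<^sub>M m) = sets (borel \<Otimes>\<^sub>M borel)"
      by (intro sets_pair_measure_cong) fact+
    then show ?thesis
      using plus by (simp add: borel_prod cong: measurable_cong_sets)
  qed
  have meas: "(\<lambda>(x, y). indicator B (x + y) :: ennreal) \<in> borel_measurable (h \<Otimes>\<^sub>M m)"
    using measurable_compose [OF sum_meas borel_measurable_indicator [OF B, where 'b = ennreal]]
    by (simp add: case_prod_beta)
  have right_slice: "(\<integral>\<^sup>+ y. indicator B (x + y) \<partial>m) = 0" for x
  proof -
    have eq: "(\<lambda>b. - x + b + 0) ` B = {y. x + y \<in> B}"
      by (force simp: image_iff simp flip: add.assoc)
    have "{y. x + y \<in> B} \<in> sets m"
      using translate_borel [OF B, of "- x" 0] eq \<open>sets m = sets borel\<close> by simp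
    moreover have "(\<integral>\<^sup>+ y. indicator B (x + y) \<partial>m) = (\<integral>\<^sup>+ y. indicator {y. x + y \<in> B} y \<partial>m)"
      by (intro nn_integral_cong) (simp add: indicator_def)
    ultimately show ?thesis
      using null [of "- x" 0] eq by simp
  qed
  have left_slice: "(\<integral>\<^sup>+ x. indicator B (x + y) \<partial>h) = emeasure h B" for y
  proof -
    have eq: "(\<lambda>b. 0 + b + - y) ` B = {x. x + y \<in> B}"
      by (force simp: image_iff)
    have "{x. x + y \<in> B} \<in> sets h"
      using translate_borel [OF B, of 0 "- y"] eq \<open>sets h = sets borel\<close> by simp
    moreover have "(\<integral>\<^sup>+ x. indicator B (x + y) \<partial>h) = (\<integral>\<^sup>+ x. indicator {x. x + y \<in> B} x \<partial>h)"
      by (intro nn_integral_cong) (simp add: indicator_def)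
    ultimately show ?thesis
      using invariant [OF B, of 0 "- y"] eq by simp
  qed
  show "emeasure h B = 0"
    using Fubini' [OF meas] by (simp add: right_slice left_slice m.emeasure_space_1)
next
  assume "emeasure h B = 0"
  with assms show "borel_shy B"
    by (auto simp: borel_shy_def)
qed

lemma haar_ambivalent_iff:
  fixes h :: "'a::{topological_group_add, second_countable_topology} measure"
  assumes h: "borel_prob h"
    and invariant: "\<And>f g X. X \<in> sets borel \<Longrightarrow> emeasure h ((\<lambda>x. f + x + g) ` X) = emeasure h X"
    and X: "X \<in> sets borel"
  shows "haar_ambivalent X \<longleftrightarrow> emeasure h X \<noteq> 0 \<and> emeasure h (- X) \<noteq> 0"
proof -
  have "sets h = sets borel"
    using h by (simp add: borel_prob_def)
  then have "shy Y \<longleftrightarrow> emeasure h Y = 0" if "Y \<in> sets borel" for Y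
    using that borel_shy_iff_null [OF h invariant] emeasure_mono [of Y _ h]
    by (metis borel_shy_def le_zero_eq order_refl shy_def)
  with X show ?thesis
    by (auto simp: haar_ambivalent_def prevalent_def)
qed

section \<open>Haar measure of the Cantor group\<close>

lemma borel_prob_bernoulli_power: "borel_prob (bernoulli_power \<theta>)"
  using statistical_structure_bernoulli_power [of "{\<theta>}"] by (simp add: statistical_structure_def)

lemma sets_bernoulli_power [measurable_cong]: "sets (bernoulli_power \<theta>) = sets borel"
  using borel_prob_bernoulli_power by (simp add: borel_prob_def)

lemma space_bernoulli_power [simp]: "space (bernoulli_power \<theta>) = UNIV"
  using sets_eq_imp_space_eq [OF sets_bernoulli_power] by simp

lemma prob_space_bernoulli_power: "prob_space (bernoulli_power \<theta>)"
  using borel_prob_bernoulli_power by (simp add: borel_prob_def)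

lemma measurable_coordinate_bit [measurable]: "(\<lambda>x :: nat \<Rightarrow> bit. x i) \<in> borel \<rightarrow>\<^sub>M count_space UNIV"
proof -
  have "(\<lambda>x. x i) \<in> bernoulli_power 0 \<rightarrow>\<^sub>M measure_pmf (bernoulli_bit 0)"
    unfolding bernoulli_power_def by (rule measurable_component_singleton) simp
  then show ?thesis
    by (simp cong: measurable_cong_sets add: sets_bernoulli_power)
qed

lemma emeasure_bernoulli_power_cylinder:
  assumes "finite J"
  shows "emeasure (bernoulli_power \<theta>) {x. \<forall>i\<in>J. x i \<in> F i} =
    (\<Prod>i\<in>J. emeasure (bernoulli_bit \<theta>) (F i))"
proof -
  have "{x. \<forall>i\<in>J. x i \<in> F i} =
      prod_emb UNIV (\<lambda>_. measure_pmf (bernoulli_bit \<theta>)) J (\<Pi>\<^sub>E i\<in>J. F i)"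
    by (auto simp: prod_emb_def PiE_iff)
  then show ?thesis
    using assms unfolding bernoulli_power_def
    by (simp add: emeasure_PiM_emb measure_pmf.prob_space_axioms)
qed

text \<open>
  The fair coin is the uniform distribution on the group with two elements; among the coins this is
  the invariant one, and its power inherits the invariance coordinate by coordinate.
\<close>

lemma map_pmf_plus_bernoulli_bit_half: "map_pmf ((+) c) (bernoulli_bit (1/2)) = bernoulli_bit (1/2)"
proof (rule pmf_eqI)
  fix i :: bit
  have half: "pmf (bernoulli_bit (1/2)) j = 1/2" for j
    by (cases j) (simp_all add: pmf_bernoulli_bit)
  have "pmf (map_pmf ((+) c) (bernoulli_bit (1/2))) (c + (i - c)) = pmf (bernoulli_bit (1/2)) (i - c)"
    by (intro pmf_map_inj') (auto simp: inj_def)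
  then show "pmf (map_pmf ((+) c) (bernoulli_bit (1/2))) i = pmf (bernoulli_bit (1/2)) i"
    unfolding half by (metis add_diff_cancel_left' add_diff_eq half)
qed

lemma distr_bernoulli_power_half_translate:
  "distr (bernoulli_power (1/2)) borel ((+) f) = bernoulli_power (1/2)"
proof -
  let ?h = "bernoulli_power (1/2)" and ?b = "bernoulli_bit (1/2)"
  interpret product_prob_space "\<lambda>_. measure_pmf ?b" "UNIV :: nat set" ..
  have [measurable]: "(+) f \<in> borel \<rightarrow>\<^sub>M borel"
    by (intro borel_measurable_continuous_onI continuous_intros)
  show ?thesis
    unfolding bernoulli_power_def [of "1/2"]
  proof (rule PiM_eq)
    show "sets (distr (\<Pi>\<^sub>M i\<in>UNIV. measure_pmf ?b) borel ((+) f)) = sets (\<Pi>\<^sub>M i\<in>UNIV. measure_pmf ?b)"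
      unfolding bernoulli_power_def [symmetric] by (simp add: sets_bernoulli_power)
  next
    fix J :: "nat set" and F :: "nat \<Rightarrow> bit set"
    assume J: "finite J"
    have cyl: "prod_emb UNIV (\<lambda>_. measure_pmf ?b) J (\<Pi>\<^sub>E i\<in>J. F i) = {x. \<forall>i\<in>J. x i \<in> F i}" for F
      by (auto simp: prod_emb_def PiE_iff)
    have "prod_emb UNIV (\<lambda>_. measure_pmf ?b) J (\<Pi>\<^sub>E i\<in>J. F i) \<in> sets ?h"
      unfolding bernoulli_power_def using J by (intro sets_PiM_I) auto
    then have "emeasure (distr ?h borel ((+) f)) {x. \<forall>i\<in>J. x i \<in> F i} =
        emeasure ?h ((+) f -` {x. \<forall>i\<in>J. x i \<in> F i})"
      by (subst emeasure_distr) (simp_all add: cyl sets_bernoulli_power)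
    also have "(+) f -` {x. \<forall>i\<in>J. x i \<in> F i} = {x. \<forall>i\<in>J. x i \<in> (+) (f i) -` F i}"
      by auto
    also have "emeasure ?h \<dots> = (\<Prod>i\<in>J. emeasure ?b ((+) (f i) -` F i))"
      using J by (rule emeasure_bernoulli_power_cylinder)
    also have "\<dots> = (\<Prod>i\<in>J. emeasure ?b (F i))"
      by (simp only: map_pmf_plus_bernoulli_bit_half emeasure_map_pmf [symmetric])
    finally show "emeasure (distr (\<Pi>\<^sub>M i\<in>UNIV. measure_pmf ?b) borel ((+) f))
        (prod_emb UNIV (\<lambda>_. measure_pmf ?b) J (\<Pi>\<^sub>E i\<in>J. F i)) = (\<Prod>i\<in>J. emeasure ?b (F i))"
      by (simp only: cyl bernoulli_power_def)
  qed
qed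

lemma bernoulli_power_half_invariant:
  assumes "X \<in> sets borel"
  shows "emeasure (bernoulli_power (1/2)) ((\<lambda>x. f + x + g) ` X) = emeasure (bernoulli_power (1/2)) X"
proof -
  \<comment> \<open>Every element is its own inverse, so the image under a translation is also a preimage under it.\<close>
  have self_inverse: "(f + g) + ((f + g) + x) = x" for x
    by (simp add: fun_eq_iff flip: add.assoc)
  have "(\<lambda>x. f + x + g) ` X = (+) (f + g) ` X"
    by (simp add: ac_simps)
  also have "\<dots> = (+) (f + g) -` X"
  proof (intro set_eqI iffI)
    fix y
    assume "y \<in> (+) (f + g) -` X"
    then have "(f + g) + ((f + g) + y) \<in> (+) (f + g) ` X"
      by blast
    then show "y \<in> (+) (f + g) ` X"
      by (simp only: self_inverse)
  next
    fix y
    assume "y \<in> (+) (f + g) ` X"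
    then show "y \<in> (+) (f + g) -` X"
      by (auto simp only: self_inverse vimage_eq)
  qed
  finally have "emeasure (bernoulli_power (1/2)) ((\<lambda>x. f + x + g) ` X) =
      emeasure (distr (bernoulli_power (1/2)) borel ((+) (f + g))) X"
    using assms
    by (subst emeasure_distr)
      (auto intro!: borel_measurable_continuous_onI continuous_intros
        simp: sets_bernoulli_power cong: measurable_cong_sets)
  then show ?thesis
    by (simp only: distr_bernoulli_power_half_translate)
qed

lemmas haar_ambivalent_bernoulli_power_half =
  haar_ambivalent_iff [OF borel_prob_bernoulli_power bernoulli_power_half_invariant]

section \<open>A strong law of large numbers\<close>

text \<open>
  Boundedness gives a short route to the strong law: by Hoeffding's inequality the probability that
  the \<open>n\<close>-th mean deviates by at least \<open>\<epsilon>\<close> decays geometrically in \<open>n\<close>, so by Borel--Cantelli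
  almost surely only finitely many means deviate that much. It is enough to do this for the
  countably many \<open>\<epsilon> = 1 / (k + 1)\<close>.
\<close>

lemma (in prob_space) strong_law_bounded_iid:
  fixes X :: "nat \<Rightarrow> 'a \<Rightarrow> real"
  assumes indep: "indep_vars (\<lambda>_. borel) X UNIV"
    and ident: "\<And>i. distr M borel (X i) = distr M borel (X 0)"
    and bounded: "AE x in M. X 0 x \<in> {a..b}"
    and "a < b"
  shows "AE x in M. (\<lambda>n. (\<Sum>i<n. X i x) / n) \<longlonglongrightarrow> expectation (X 0)"
proof -
  let ?\<mu> = "expectation (X 0)"
  have [measurable]: "random_variable borel (X i)" for i
    using indep by (auto simp: indep_vars_def)
  have close: "AE x in M. \<forall>\<^sub>F n in sequentially. \<bar>(\<Sum>i<n. X i x) / n - ?\<mu>\<bar> < \<epsilon>" if "\<epsilon> > 0" for \<epsilon>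
  proof -
    define D where "D n = {x \<in> space M. \<epsilon> \<le> \<bar>(\<Sum>i<n. X i x) / n - ?\<mu>\<bar>}" for n :: nat
    define q where "q = exp (- 2 * \<epsilon>\<^sup>2 / (b - a)\<^sup>2)"
    have "0 \<le> q" "q < 1"
      using that \<open>a < b\<close> by (simp_all add: q_def)
    have "prob (D n) \<le> 2 * q ^ n" for n
    proof (cases "n = 0")
      case False
      interpret Hoeffding_ineq_iid M "{..<n}" X "X 0" a b ?\<mu>
      proof unfold_locales
        show "indep_vars (\<lambda>_. borel) X {..<n}"
          using indep by (rule indep_vars_subset) simp
        show "distr M borel (X i) = distr M borel (X 0)" for i
          by (rule ident)
        show "AE x in M. X 0 x \<in> {a..b}"
          by (rule bounded)
        show "finite {..<n}"
          by simp
        show "random_variable borel (X 0)"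
          by measurable
      qed
      have "{..<n} \<noteq> {}"
        using False by auto
      with that \<open>a < b\<close> have "prob (D n) \<le> 2 * exp (- 2 * real n * \<epsilon>\<^sup>2 / (b - a)\<^sup>2)"
        using Hoeffding_ineq_abs_ge' [of \<epsilon>] by (simp only: D_def card_lessThan less_imp_le not_False_eq_True)
      also have "- 2 * real n * \<epsilon>\<^sup>2 / (b - a)\<^sup>2 = real n * (- 2 * \<epsilon>\<^sup>2 / (b - a)\<^sup>2)"
        by simp
      also have "exp \<dots> = q ^ n"
        unfolding q_def by (rule exp_of_nat_mult)
      finally show ?thesis .
      \<comment> \<open>Hoeffding's inequality concerns nonempty index sets; for \<open>n = 0\<close> the bound is \<open>2\<close>.\<close>
    qed (simp add: order_trans [OF prob_le_1])
    moreover have "summable (\<lambda>n. 2 * q ^ n)"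
      using \<open>0 \<le> q\<close> \<open>q < 1\<close> by (intro summable_mult summable_geometric) simp
    ultimately have "summable (\<lambda>n. prob (D n))"
      by - (rule summable_comparison_test' [of "\<lambda>n. 2 * q ^ n" 0], simp_all)
    moreover have "D n \<in> events" for n
      unfolding D_def by measurable
    ultimately have "AE x in M. \<forall>\<^sub>F n in sequentially. x \<in> space M - D n"
      by (intro borel_cantelli_AE1) (simp_all add: emeasure_eq_measure)
    then show ?thesis
      by eventually_elim (auto elim!: eventually_mono simp: D_def not_le)
  qed
  have "AE x in M. \<forall>k :: nat. \<forall>\<^sub>F n in sequentially. \<bar>(\<Sum>i<n. X i x) / n - ?\<mu>\<bar> < 1 / Suc k"
    by (intro AE_all_countable [THEN iffD2] allI close) simp
  then show ?thesis
  proof eventually_elim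
    case (elim x)
    show ?case
    proof (rule tendstoI)
      fix e :: real
      assume "0 < e"
      then obtain k :: nat where "1 / Suc k < e"
        using nat_approx_posE by blast
      with elim [rule_format, of k] show "\<forall>\<^sub>F n in sequentially. dist ((\<Sum>i<n. X i x) / n) ?\<mu> < e"
        by (auto simp: dist_real_def elim!: eventually_mono)
    qed
  qed
qed

text \<open>
  On sequences whose means diverge, \<^const>\<open>lim\<close> has a default value that is not specified. This is
  harmless: such sequences form a null set for every Bernoulli power, and measurability holds with
  any constant default.
\<close>

definition frequency :: "(nat \<Rightarrow> bit) \<Rightarrow> real"
  where "frequency x = lim (\<lambda>n. (\<Sum>i<n. of_bool (x i = 1)) / n)"

lemma measurable_frequency [measurable]: "frequency \<in> borel_measurable borel"
proof -
  have [measurable]: "(\<lambda>x :: nat \<Rightarrow> bit. of_bool (x i = 1) :: real) \<in> borel_measurable borel" for i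
    by (rule measurable_compose [OF measurable_coordinate_bit]) simp
  show ?thesis
    unfolding frequency_def by measurable
qed

lemma AE_frequency_bernoulli_power:
  assumes "0 \<le> \<theta>" "\<theta> \<le> 1"
  shows "AE x in bernoulli_power \<theta>. frequency x = \<theta>"
proof -
  let ?b = "measure_pmf (bernoulli_bit \<theta>)" and ?val = "\<lambda>c :: bit. of_bool (c = 1) :: real"
  interpret prob_space "bernoulli_power \<theta>"
    by (rule prob_space_bernoulli_power)
  have component: "(\<lambda>x. x i) \<in> bernoulli_power \<theta> \<rightarrow>\<^sub>M ?b" for i
    unfolding bernoulli_power_def by (rule measurable_component_singleton) simp
  have distr_component: "distr (bernoulli_power \<theta>) ?b (\<lambda>x. x i) = ?b" for i
    unfolding bernoulli_power_def
    by (rule distr_PiM_component) (simp_all add: measure_pmf.prob_space_axioms)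
  have "indep_vars (\<lambda>_. ?b) (\<lambda>i x. x i) UNIV"
    using component
    by (subst indep_vars_iff_distr_eq_PiM)
      (simp_all add: distr_component, simp add: bernoulli_power_def restrict_def)
  then have indep: "indep_vars (\<lambda>_. borel) (\<lambda>i x. ?val (x i)) UNIV"
    by (rule indep_vars_compose2) simp
  have ident: "distr (bernoulli_power \<theta>) borel (\<lambda>x. ?val (x i)) = distr ?b borel ?val" for i
    using distr_distr [of ?val ?b borel "\<lambda>x. x i" "bernoulli_power \<theta>"]
    by (simp add: component distr_component comp_def)
  have "expectation (\<lambda>x. ?val (x 0)) = (\<integral>c. ?val c \<partial>?b)"
    using integral_distr [of "\<lambda>x. x 0" "bernoulli_power \<theta>" ?b ?val]
    by (simp add: component distr_component)
  also have "\<dots> = \<theta>"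
    using assms by (subst integral_measure_pmf_real [of "{1}"]) (simp_all add: pmf_bernoulli_bit)
  finally have "expectation (\<lambda>x. ?val (x 0)) = \<theta>" .
  then have "AE x in bernoulli_power \<theta>. (\<lambda>n. (\<Sum>i<n. ?val (x i)) / n) \<longlonglongrightarrow> \<theta>"
    using strong_law_bounded_iid [OF indep, of 0 1] ident by simp
  then show ?thesis
    by eventually_elim (simp add: frequency_def limI)
qed

section \<open>Objective consistent estimates\<close>

lemma measurable_singleton_algebraI:
  assumes "T \<in> space M \<rightarrow> \<Theta>"
    and "\<And>\<theta>. \<theta> \<in> \<Theta> \<Longrightarrow> T -` {\<theta>} \<inter> space M \<in> sets M"
  shows "T \<in> M \<rightarrow>\<^sub>M singleton_algebra \<Theta>"
  unfolding singleton_algebra_def by (rule measurable_measure_of) (use assms in auto)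

text \<open>
  The image measure under \<open>T\<close> has an atom at every point of \<open>\<Theta>\<close>, and a finite measure has only
  countably many atoms.
\<close>

lemma countable_if_fibres_positive:
  assumes "finite_measure M"
    and T: "T \<in> M \<rightarrow>\<^sub>M singleton_algebra \<Theta>"
    and pos: "\<And>\<theta>. \<theta> \<in> \<Theta> \<Longrightarrow> emeasure M (T -` {\<theta>} \<inter> space M) \<noteq> 0"
  shows "countable \<Theta>"
proof -
  interpret D: finite_measure "distr M (singleton_algebra \<Theta>) T"
    using assms by (intro finite_measure.finite_measure_distr)
  have "measure (distr M (singleton_algebra \<Theta>) T) {\<theta>} \<noteq> 0" if "\<theta> \<in> \<Theta>" for \<theta>
  proof -
    have "{\<theta>} \<in> sets (singleton_algebra \<Theta>)"
      using that unfolding singleton_algebra_def by (subst sets_measure_of) auto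
    then have "emeasure (distr M (singleton_algebra \<Theta>) T) {\<theta>} \<noteq> 0"
      using pos [OF that] T by (simp add: emeasure_distr)
    then show ?thesis
      by (simp add: D.emeasure_eq_measure)
  qed
  then have "\<Theta> \<subseteq> {\<theta>. measure (distr M (singleton_algebra \<Theta>) T) {\<theta>} \<noteq> 0}"
    by blast
  then show ?thesis
    using D.countable_support countable_subset by blast
qed

definition first_one :: "(nat \<Rightarrow> bit) \<Rightarrow> nat"
  where "first_one x = (LEAST i. x i = 1)"

lemma measurable_first_one [measurable]: "first_one \<in> borel \<rightarrow>\<^sub>M count_space UNIV"
proof -
  have [measurable]: "Measurable.pred borel (\<lambda>x :: nat \<Rightarrow> bit. x i = 1)" for i
    by (rule measurable_compose [OF measurable_coordinate_bit]) simp
  show ?thesis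
    unfolding first_one_def by measurable
qed

text \<open>
  The event contains the cylinder of all sequences that start with \<open>n\<close> zeros and a one. The default
  value of \<^const>\<open>first_one\<close> at the zero sequence can only enlarge the event.
\<close>

lemma bernoulli_power_half_first_one: "emeasure (bernoulli_power (1/2)) {x. first_one x = n} \<noteq> 0"
proof -
  let ?h = "bernoulli_power (1/2)"
  define c :: "nat \<Rightarrow> bit" where "c i = of_bool (i = n)" for i
  have "pmf (bernoulli_bit (1/2)) j \<noteq> 0" for j
    by (cases j) (simp_all add: pmf_bernoulli_bit)
  then have "0 < (\<Prod>i\<le>n. emeasure (bernoulli_bit (1/2)) {c i})"
    by (simp add: emeasure_pmf_single zero_less_iff_neq_zero)
  also have "\<dots> = emeasure ?h {x. \<forall>i\<in>{..n}. x i \<in> {c i}}"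
    by (rule emeasure_bernoulli_power_cylinder [symmetric]) simp
  also have "\<dots> \<le> emeasure ?h {x. first_one x = n}"
  proof (rule emeasure_mono)
    show "{x. \<forall>i\<in>{..n}. x i \<in> {c i}} \<subseteq> {x. first_one x = n}"
    proof
      fix x :: "nat \<Rightarrow> bit"
      assume "x \<in> {x. \<forall>i\<in>{..n}. x i \<in> {c i}}"
      then have x: "x i = c i" if "i \<le> n" for i
        using that by simp
      have "n \<le> i" if "x i = 1" for i
        using that x [of i] by (cases "i < n") (simp_all add: c_def)
      with x [of n] show "x \<in> {x. first_one x = n}"
        by (auto simp: first_one_def c_def intro: Least_equality)
    qed
    have "first_one -` {n} \<inter> space borel \<in> sets borel"
      by measurable
    then show "{x. first_one x = n} \<in> sets ?h"
      by (simp add: sets_bernoulli_power vimage_def)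
  qed
  finally show ?thesis
    by simp
qed

lemma objective_consistent_estimate_necessary:
  assumes "objective_consistent_estimate \<Theta> bernoulli_power T"
  shows "countable \<Theta>" and "1/2 \<notin> \<Theta>"
proof -
  let ?h = "bernoulli_power (1/2)"
  interpret h: prob_space ?h
    by (rule prob_space_bernoulli_power)
  have T: "T \<in> borel \<rightarrow>\<^sub>M singleton_algebra \<Theta>"
    and one: "\<And>\<theta>. \<theta> \<in> \<Theta> \<Longrightarrow> emeasure (bernoulli_power \<theta>) (T -` {\<theta>}) = 1"
    and ambivalent: "\<And>\<theta>. \<theta> \<in> \<Theta> \<Longrightarrow> haar_ambivalent (T -` {\<theta>})"
    using assms by (simp_all add: objective_consistent_estimate_def)
  have fibre: "T -` {\<theta>} \<in> sets borel" if "\<theta> \<in> \<Theta>" for \<theta>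
    using ambivalent [OF that] by (simp add: haar_ambivalent_def)
  have T': "T \<in> ?h \<rightarrow>\<^sub>M singleton_algebra \<Theta>"
    using T by (simp add: sets_bernoulli_power cong: measurable_cong_sets)
  show "countable \<Theta>"
    using h.finite_measure_axioms T'
    by (rule countable_if_fibres_positive)
      (use ambivalent fibre in \<open>simp add: haar_ambivalent_bernoulli_power_half\<close>)
  show "1/2 \<notin> \<Theta>"
  proof
    assume half: "1/2 \<in> \<Theta>"
    have "emeasure ?h (- (T -` {1/2})) = 0"
      using emeasure_compl [of "T -` {1/2}" ?h] one [OF half] fibre [OF half] h.emeasure_space_1
      by (simp add: Compl_eq_Diff_UNIV sets_bernoulli_power)
    with ambivalent [OF half] fibre [OF half] show False
      by (simp add: haar_ambivalent_bernoulli_power_half)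
  qed
qed

text \<open>
  The second branch is reached \<open>h\<close>-almost surely if \<open>1/2 \<notin> \<Theta>\<close>, and there it spreads the mass of the
  Haar measure \<open>h\<close> over all parameters. For finite \<open>\<Theta>\<close>, \<^const>\<open>from_nat_into\<close> sends the superfluous
  indices to some element of \<open>\<Theta>\<close>, so that the values remain in \<open>\<Theta>\<close>.
\<close>

definition frequency_estimate :: "real set \<Rightarrow> (nat \<Rightarrow> bit) \<Rightarrow> real"
  where "frequency_estimate \<Theta> x =
    (if frequency x \<in> \<Theta> then frequency x else from_nat_into \<Theta> (first_one x))"

lemma objective_consistent_estimate_frequency:
  assumes "\<Theta> \<subseteq> {0<..<1}" and "countable \<Theta>" and "1/2 \<notin> \<Theta>"
    and two: "\<And>\<theta>. \<exists>\<theta>'\<in>\<Theta>. \<theta>' \<noteq> \<theta>"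
  shows "objective_consistent_estimate \<Theta> bernoulli_power (frequency_estimate \<Theta>)"
proof -
  let ?T = "frequency_estimate \<Theta>" and ?h = "bernoulli_power (1/2)"
  have "\<Theta> \<noteq> {}"
    using two by blast
  have [measurable]: "\<Theta> \<in> sets borel"
    using \<open>countable \<Theta>\<close> by (rule sets.countable [rotated]) simp
  have [measurable]: "(\<lambda>x. from_nat_into \<Theta> (first_one x)) \<in> borel_measurable borel"
    by (rule measurable_compose [OF measurable_first_one]) simp
  have T: "?T \<in> borel_measurable borel"
    unfolding frequency_estimate_def by measurable
  have fibre: "?T -` {\<theta>} \<in> sets borel" for \<theta>
    using measurable_sets [OF T, of "{\<theta>}"] by simp
  have into: "?T x \<in> \<Theta>" for x
    using from_nat_into [OF \<open>\<Theta> \<noteq> {}\<close>] by (simp add: frequency_estimate_def)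
  have estimates: "emeasure (bernoulli_power \<theta>) (?T -` {\<theta>}) = 1" if "\<theta> \<in> \<Theta>" for \<theta>
  proof -
    interpret prob_space "bernoulli_power \<theta>"
      by (rule prob_space_bernoulli_power)
    have "AE x in bernoulli_power \<theta>. frequency x = \<theta>"
      using that assms(1) by (intro AE_frequency_bernoulli_power) auto
    then have "AE x in bernoulli_power \<theta>. x \<in> ?T -` {\<theta>}"
      by eventually_elim (use that in \<open>simp add: frequency_estimate_def\<close>)
    then show ?thesis
      using fibre by (intro emeasure_eq_1_AE) (simp add: sets_bernoulli_power)
  qed
  \<comment> \<open>The fibre of \<open>\<theta>\<close> contains, up to a null set, the event that the first one occurs at the
    index of \<open>\<theta>\<close> in the enumeration.\<close>
  have fibre_pos: "emeasure ?h (?T -` {\<theta>}) \<noteq> 0" if "\<theta> \<in> \<Theta>" for \<theta>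
  proof
    assume "emeasure ?h (?T -` {\<theta>}) = 0"
    then have "AE x in ?h. x \<notin> ?T -` {\<theta>}"
      using fibre by (intro AE_not_in) (simp add: null_sets_def sets_bernoulli_power)
    moreover have "AE x in ?h. frequency x = 1/2"
      by (rule AE_frequency_bernoulli_power) simp_all
    ultimately have "AE x in ?h. \<not> first_one x = to_nat_on \<Theta> \<theta>"
      by eventually_elim
        (use that \<open>countable \<Theta>\<close> \<open>1/2 \<notin> \<Theta>\<close> in \<open>auto simp: frequency_estimate_def\<close>)
    moreover have "first_one -` {to_nat_on \<Theta> \<theta>} \<inter> space borel \<in> sets borel"
      by measurable
    ultimately show False
      using bernoulli_power_half_first_one [of "to_nat_on \<Theta> \<theta>"]
        AE_iff_measurable [of "{x. first_one x = to_nat_on \<Theta> \<theta>}" ?h "\<lambda>x. \<not> first_one x = to_nat_on \<Theta> \<theta>"]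
      by (simp add: sets_bernoulli_power vimage_def)
  qed
  have ambivalent: "haar_ambivalent (?T -` {\<theta>})" if "\<theta> \<in> \<Theta>" for \<theta>
  proof -
    obtain \<theta>' where "\<theta>' \<in> \<Theta>" "\<theta>' \<noteq> \<theta>"
      using two by blast
    then have "?T -` {\<theta>'} \<subseteq> - (?T -` {\<theta>})"
      by auto
    then have "emeasure ?h (?T -` {\<theta>'}) \<le> emeasure ?h (- (?T -` {\<theta>}))"
      using fibre by (intro emeasure_mono) (simp_all add: sets_bernoulli_power)
    with fibre_pos [OF \<open>\<theta>' \<in> \<Theta>\<close>] fibre_pos [OF that] fibre show ?thesis
      by (auto simp: haar_ambivalent_bernoulli_power_half)
  qed
  show ?thesis
    unfolding objective_consistent_estimate_def
    using statistical_structure_bernoulli_power into fibre estimates ambivalent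
    by (auto intro: measurable_singleton_algebraI)
qed

theorem theorem7p5:
  fixes \<Theta>\<^sub>1 :: "real set"
  assumes "\<Theta>\<^sub>1 \<subseteq> {0<..<1}"
    and "infinite \<Theta>\<^sub>1 \<or> card \<Theta>\<^sub>1 \<ge> 2"
  shows "(\<exists>T. objective_consistent_estimate \<Theta>\<^sub>1 bernoulli_power T) \<longleftrightarrow>
    countable \<Theta>\<^sub>1 \<and> 1/2 \<notin> \<Theta>\<^sub>1"
proof
  assume "\<exists>T. objective_consistent_estimate \<Theta>\<^sub>1 bernoulli_power T"
  then show "countable \<Theta>\<^sub>1 \<and> 1/2 \<notin> \<Theta>\<^sub>1"
    using objective_consistent_estimate_necessary by blast
next
  assume "countable \<Theta>\<^sub>1 \<and> 1/2 \<notin> \<Theta>\<^sub>1"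
  moreover have "\<exists>\<theta>'\<in>\<Theta>\<^sub>1. \<theta>' \<noteq> \<theta>" for \<theta>
  proof (rule ccontr)
    assume "\<not> (\<exists>\<theta>'\<in>\<Theta>\<^sub>1. \<theta>' \<noteq> \<theta>)"
    then have "\<Theta>\<^sub>1 \<subseteq> {\<theta>}"
      by blast
    then have "finite \<Theta>\<^sub>1" "card \<Theta>\<^sub>1 \<le> 1"
      using finite_subset card_mono [of "{\<theta>}" \<Theta>\<^sub>1] by auto
    with assms(2) show False
      by simp
  qed
  ultimately show "\<exists>T. objective_consistent_estimate \<Theta>\<^sub>1 bernoulli_power T"
    using assms(1) objective_consistent_estimate_frequency by blast
qed

end
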